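(* Let $X$ be a non-negative random variable with absolutely continuous distribution function $F$ and with $E(X^2)<\infty$. Then the cumulative extropy $\mathcal{CJ}(X)$ and the weighted cumulative extropy $\mathcal{CJW}(X)$ satisfy $$\mathcal{CJ}(X)=-\mathcal{M}_{1,1,0}\quad\text{and}\quad \mathcal{CJW}(X)=-\frac12\mathcal{M}_{2,1,0}.$$
   Context: Let $X_1,X_2$ be independent with distribution function $F$. The cumulative extropy and the weighted cumulative extropy are taken in the form $$\mathcal{CJ}(X)=-\frac12E(\max(X_1,X_2)),\qquad \mathcal{CJW}(X)=-\frac14E\big(\max(X_1,X_2)^2\big).$$ For real $p,r,s$ for which the expectation exists, the probability weighted moment of $X$ is $\mathcal{M}_{p,r,s}=E\{X^pF^r(X)(1-F(X))^s\}$. *)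

theory Defs
  imports "HOL-Probability.Probability"
begin

definition distribution_function :: "'a measure \<Rightarrow> ('a \<Rightarrow> real) \<Rightarrow> real \<Rightarrow> real" where
  "distribution_function M X = cdf (distr M borel X)"

lemma distribution_function_eq_prob:
  assumes "X \<in> borel_measurable M"
  shows "distribution_function M X x = measure M {\<omega> \<in> space M. X \<omega> \<le> x}"
proof -
  have "X -` {..x} \<inter> space M = {\<omega> \<in> space M. X \<omega> \<le> x}" by auto
  then show ?thesis
    using assms by (simp add: distribution_function_def cdf_def measure_distr)
qed

definition absolutely_continuous_function :: "(real \<Rightarrow> real) \<Rightarrow> bool" where
  "absolutely_continuous_function F \<longleftrightarrow>
     (\<forall>\<epsilon>>0. \<exists>\<delta>>0. \<forall>I :: (real \<times> real) set.
        finite I \<longrightarrow> (\<forall>(a, b)\<in>I. a < b) \<longrightarrow> disjoint_family_on (\<lambda>(a, b). {a<..<b}) I \<longrightarrow>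
        (\<Sum>(a, b)\<in>I. b - a) < \<delta> \<longrightarrow> (\<Sum>(a, b)\<in>I. \<bar>F b - F a\<bar>) < \<epsilon>)"

text \<open>
  The independent copies of a random variable \<open>X\<close> on \<open>M\<close> are realised on the product space,
  as \<open>X\<close> of the first and \<open>X\<close> of the second coordinate. The lemmas \<open>cumulative_extropy_eq\<close> and
  \<open>weighted_cumulative_extropy_eq\<close> below show that any other pair of independent random variables
  with the distribution function of \<open>X\<close>, on any probability space, gives the same values.
\<close>

definition cumulative_extropy :: "'a measure \<Rightarrow> ('a \<Rightarrow> real) \<Rightarrow> real" where
  "cumulative_extropy M X =
     - (1 / 2) * (LINT \<omega>|(M \<Otimes>\<^sub>M M). max (X (fst \<omega>)) (X (snd \<omega>)))"

definition weighted_cumulative_extropy :: "'a measure \<Rightarrow> ('a \<Rightarrow> real) \<Rightarrow> real" where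
  "weighted_cumulative_extropy M X =
     - (1 / 4) * (LINT \<omega>|(M \<Otimes>\<^sub>M M). (max (X (fst \<omega>)) (X (snd \<omega>)))\<^sup>2)"

text \<open>
  The library's \<open>powr\<close> has \<open>0 powr 0 = 0\<close> and is meant for positive bases. For integer exponents
  the ordinary integer power is used instead, so that \<open>x\<^sup>0 = 1\<close> for every \<open>x\<close> and \<open>x\<^sup>p\<close> has its
  usual meaning for negative \<open>x\<close> too.
\<close>

definition real_power :: "real \<Rightarrow> real \<Rightarrow> real" where
  "real_power x a = (if a \<in> \<int> then x powi \<lfloor>a\<rfloor> else x powr a)"

lemma real_power_0 [simp]: "real_power x 0 = 1"
  by (simp add: real_power_def)

lemma real_power_1 [simp]: "real_power x 1 = x"
  by (simp add: real_power_def)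

lemma real_power_numeral [simp]: "real_power x (numeral n) = x ^ numeral n"
  by (simp add: real_power_def)

lemma real_power_eq_powr: "x > 0 \<Longrightarrow> real_power x a = x powr a"
  by (auto simp: real_power_def powr_real_of_int' elim!: Ints_cases)

definition prob_weighted_moment ::
    "'a measure \<Rightarrow> ('a \<Rightarrow> real) \<Rightarrow> real \<Rightarrow> real \<Rightarrow> real \<Rightarrow> real" where
  "prob_weighted_moment M X p r s =
     (LINT \<omega>|M. real_power (X \<omega>) p * real_power (distribution_function M X (X \<omega>)) r
               * real_power (1 - distribution_function M X (X \<omega>)) s)"

lemma integral_independent_copies:
  fixes h :: "real \<times> real \<Rightarrow> real"
  assumes M: "prob_space M" and X: "X \<in> borel_measurable M"
    and N: "prob_space N" and ind: "prob_space.indep_var N borel X1 borel X2"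
    and F1: "distribution_function N X1 = distribution_function M X"
    and F2: "distribution_function N X2 = distribution_function M X"
    and h: "h \<in> borel_measurable (borel \<Otimes>\<^sub>M borel)"
  shows "(LINT \<omega>|N. h (X1 \<omega>, X2 \<omega>)) = (LINT \<omega>|(M \<Otimes>\<^sub>M M). h (X (fst \<omega>), X (snd \<omega>)))"
proof -
  interpret M: prob_space M by fact
  interpret N: prob_space N by fact
  have m [measurable]: "X1 \<in> borel_measurable N" "X2 \<in> borel_measurable N"
    and j: "distr N borel X1 \<Otimes>\<^sub>M distr N borel X2 = distr N (borel \<Otimes>\<^sub>M borel) (\<lambda>x. (X1 x, X2 x))"
    using ind unfolding N.indep_var_distribution_eq by auto
  note [measurable] = X h
  have d: "distr N borel X1 = distr M borel X" "distr N borel X2 = distr M borel X"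
    using F1 F2 unfolding distribution_function_def
    by (auto intro!: cdf_unique M.real_distribution_distr N.real_distribution_distr)
  interpret D: prob_space "distr M borel X" by (rule M.prob_space_distr) (rule X)
  have "(LINT \<omega>|N. h (X1 \<omega>, X2 \<omega>))
      = (LINT z|distr N (borel \<Otimes>\<^sub>M borel) (\<lambda>x. (X1 x, X2 x)). h z)"
    by (subst integral_distr) auto
  also have "\<dots> = (LINT z|(distr M borel X \<Otimes>\<^sub>M distr M borel X). h z)"
    by (simp add: j [symmetric] d)
  also have "\<dots> = (LINT z|distr (M \<Otimes>\<^sub>M M) (borel \<Otimes>\<^sub>M borel) (\<lambda>(x, y). (X x, X y)). h z)"
    by (subst pair_measure_distr[OF X X D.sigma_finite_measure_axioms]) simp
  also have "\<dots> = (LINT \<omega>|(M \<Otimes>\<^sub>M M). h (X (fst \<omega>), X (snd \<omega>)))"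
    by (subst integral_distr) (auto simp: case_prod_beta)
  finally show ?thesis .
qed

lemma cumulative_extropy_eq:
  assumes "prob_space M" "X \<in> borel_measurable M"
    and "prob_space N" "prob_space.indep_var N borel X1 borel X2"
    and "distribution_function N X1 = distribution_function M X"
    and "distribution_function N X2 = distribution_function M X"
  shows "cumulative_extropy M X = - (1 / 2) * (LINT \<omega>|N. max (X1 \<omega>) (X2 \<omega>))"
  using integral_independent_copies[OF assms, of "\<lambda>z. max (fst z) (snd z)"]
  by (simp add: cumulative_extropy_def)

lemma weighted_cumulative_extropy_eq:
  assumes "prob_space M" "X \<in> borel_measurable M"
    and "prob_space N" "prob_space.indep_var N borel X1 borel X2"
    and "distribution_function N X1 = distribution_function M X"
    and "distribution_function N X2 = distribution_function M X"
  shows "weighted_cumulative_extropy M X = - (1 / 4) * (LINT \<omega>|N. (max (X1 \<omega>) (X2 \<omega>))\<^sup>2)"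
  using integral_independent_copies[OF assms, of "\<lambda>z. (max (fst z) (snd z))\<^sup>2"]
  by (simp add: weighted_cumulative_extropy_def)

text \<open>
  The expectations in both extropies and in the moments with \<open>p \<in> {1, 2}\<close>, \<open>r = 1\<close>, \<open>s = 0\<close> exist
  when \<open>E(X\<^sup>2)\<close> is finite, so none of these Bochner integrals takes the default value \<open>0\<close> of
  a non-integrable function.
\<close>

lemma expectations_exist:
  assumes M: "prob_space M" and X: "X \<in> borel_measurable M"
    and X2: "integrable M (\<lambda>\<omega>. (X \<omega>)\<^sup>2)"
  shows "integrable (M \<Otimes>\<^sub>M M) (\<lambda>\<omega>. max (X (fst \<omega>)) (X (snd \<omega>)))"
    and "integrable (M \<Otimes>\<^sub>M M) (\<lambda>\<omega>. (max (X (fst \<omega>)) (X (snd \<omega>)))\<^sup>2)"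
    and "p \<in> {1, 2} \<Longrightarrow>
      integrable M (\<lambda>\<omega>. real_power (X \<omega>) p * real_power (distribution_function M X (X \<omega>)) 1
               * real_power (1 - distribution_function M X (X \<omega>)) 0)"
proof -
  interpret M: prob_space M by fact
  interpret P: pair_prob_space M M ..
  note [measurable] = X
  have X1: "integrable M X"
    using M.square_integrable_imp_integrable[OF X X2] .
  have fst: "distr (M \<Otimes>\<^sub>M M) M fst = M" by (rule M.distr_pair_fst)
  have snd: "distr (M \<Otimes>\<^sub>M M) M snd = M"
  proof -
    have "distr (M \<Otimes>\<^sub>M M) M snd = distr (distr (M \<Otimes>\<^sub>M M) (M \<Otimes>\<^sub>M M) (\<lambda>(x, y). (y, x))) M snd"
      using P.distr_pair_swap by simp
    also have "\<dots> = distr (M \<Otimes>\<^sub>M M) M fst"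
      by (subst distr_distr) (auto simp: comp_def case_prod_beta)
    finally show ?thesis by (simp add: fst)
  qed
  have copies: "integrable (M \<Otimes>\<^sub>M M) (\<lambda>\<omega>. g (fst \<omega>))" "integrable (M \<Otimes>\<^sub>M M) (\<lambda>\<omega>. g (snd \<omega>))"
    if "integrable M g" for g :: "_ \<Rightarrow> real"
    using integrable_distr[of fst "M \<Otimes>\<^sub>M M" M g] integrable_distr[of snd "M \<Otimes>\<^sub>M M" M g] that
    by (simp_all add: fst snd)
  show "integrable (M \<Otimes>\<^sub>M M) (\<lambda>\<omega>. max (X (fst \<omega>)) (X (snd \<omega>)))"
    by (intro integrable_max copies X1)
  show "integrable (M \<Otimes>\<^sub>M M) (\<lambda>\<omega>. (max (X (fst \<omega>)) (X (snd \<omega>)))\<^sup>2)"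
  proof (rule Bochner_Integration.integrable_bound)
    show "integrable (M \<Otimes>\<^sub>M M) (\<lambda>\<omega>. (X (fst \<omega>))\<^sup>2 + (X (snd \<omega>))\<^sup>2)"
      by (intro Bochner_Integration.integrable_add copies[of "\<lambda>\<omega>. (X \<omega>)\<^sup>2"] X2)
  qed (auto simp: max_def)
  interpret D: prob_space "distr M borel X" by (rule M.prob_space_distr) (rule X)
  interpret D: real_distribution "distr M borel X" by (rule M.real_distribution_distr) (rule X)
  have [measurable]: "distribution_function M X \<in> borel_measurable borel"
    unfolding distribution_function_def
    by (intro borel_measurable_mono monoI D.cdf_nondecreasing)
  have b: "\<bar>distribution_function M X x\<bar> \<le> 1" for x
    by (simp add: distribution_function_def cdf_def)
  have "integrable M (\<lambda>\<omega>. g \<omega> * distribution_function M X (X \<omega>))"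
    if g: "integrable M g" for g :: "_ \<Rightarrow> real"
  proof (rule Bochner_Integration.integrable_bound[OF g])
    show "(\<lambda>\<omega>. g \<omega> * distribution_function M X (X \<omega>)) \<in> borel_measurable M"
      using borel_measurable_integrable[OF g] by measurable
  qed (auto simp: abs_mult intro!: AE_I2 mult_left_le b)
  from this[OF X1] this[OF X2]
  show "p \<in> {1, 2} \<Longrightarrow>
      integrable M (\<lambda>\<omega>. real_power (X \<omega>) p * real_power (distribution_function M X (X \<omega>)) 1
               * real_power (1 - distribution_function M X (X \<omega>)) 0)"
    by auto
qed

end

theory Submission
  imports Defs
begin

text \<open>
  The distribution of \<open>X\<close> has no atoms, so ties between two independent copies are negligible and
  \<open>g (max x y) = g x * 1[y \<le> x] + g y * 1[x \<le> y]\<close> almost everywhere. The two summands have the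
  same integral by symmetry, and integrating out the smaller variable gives \<open>E (g X * F X)\<close>.
\<close>

text \<open>A family consisting of one interval already gives the usual epsilon-delta condition.
  Continuity is the form in which absolute continuity enters below: it excludes atoms.\<close>

lemma absolutely_continuous_function_isCont:
  assumes "absolutely_continuous_function F"
  shows "isCont F x"
  unfolding continuous_at_eps_delta
proof (intro allI impI)
  fix e :: real assume "e > 0"
  then obtain d where d: "d > 0"
    and *: "\<And>I. finite I \<Longrightarrow> (\<forall>(a, b)\<in>I. a < b) \<Longrightarrow> disjoint_family_on (\<lambda>(a, b). {a<..<b}) I \<Longrightarrow>
              (\<Sum>(a, b)\<in>I. b - a) < d \<Longrightarrow> (\<Sum>(a, b)\<in>I. \<bar>F b - F a\<bar>) < e"
    using assms unfolding absolutely_continuous_function_def by meson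
  have small: "\<bar>F b - F a\<bar> < e" if "a < b" "b - a < d" for a b
    using *[of "{(a, b)}"] that by (simp add: disjoint_family_on_def)
  have "dist (F y) (F x) < e" if "dist y x < d" for y
    using small[of x y] small[of y x] that \<open>e > 0\<close>
    by (cases x y rule: linorder_cases) (auto simp: dist_real_def)
  with d show "\<exists>d>0. \<forall>y. dist y x < d \<longrightarrow> dist (F y) (F x) < e" by blast
qed

text \<open>Keeping \<open>g\<close> general makes both identities instances, with
  \<open>g x = x\<close> and \<open>g x = x^2\<close>.\<close>

lemma (in prob_space) integral_max_independent_copies:
  fixes X :: "'a \<Rightarrow> real" and g :: "real \<Rightarrow> real"
  assumes X [measurable]: "X \<in> borel_measurable M"
    and cont: "\<And>x. isCont (distribution_function M X) x"
    and g [measurable]: "g \<in> borel_measurable borel"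
    and int: "integrable M (\<lambda>\<omega>. g (X \<omega>))"
  shows "(LINT \<omega>|(M \<Otimes>\<^sub>M M). g (max (X (fst \<omega>)) (X (snd \<omega>))))
       = 2 * (LINT \<omega>|M. g (X \<omega>) * distribution_function M X (X \<omega>))"
proof -
  interpret P: pair_prob_space M M ..
  interpret D: real_distribution "distr M borel X" by (rule real_distribution_distr) (rule X)
  \<comment> \<open>The part of \<open>g (max ...)\<close> where the first copy is at least the
    second. The half-line is closed so that integrating over \<open>y\<close> gives exactly the
    distribution function at \<open>X x\<close>.\<close>
  define h where "h = (\<lambda>(x, y). g (X x) * indicator {..X x} (X y))"
  have h_meas [measurable]: "h \<in> borel_measurable (M \<Otimes>\<^sub>M M)"
    unfolding h_def indicator_def atMost_iff by measurable
  have h_int: "integrable (M \<Otimes>\<^sub>M M) h"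
  proof (rule Bochner_Integration.integrable_bound)
    show "integrable (M \<Otimes>\<^sub>M M) (\<lambda>z. g (X (fst z)))"
      using integrable_distr[of fst "M \<Otimes>\<^sub>M M" M "\<lambda>\<omega>. g (X \<omega>)"] int
      by (simp add: distr_pair_fst)
  qed (auto simp: h_def indicator_def)
  have no_tie: "AE y in M. X y \<noteq> c" for c
  proof -
    \<comment> \<open>The mass of a point is the jump of the distribution function there.\<close>
    have "measure (distr M borel X) {c} = 0"
      using cont[of c] D.isCont_cdf by (simp add: distribution_function_def)
    then have "AE z in distr M borel X. z \<noteq> c"
      by (intro AE_I[where N = "{c}"]) (auto simp: D.emeasure_eq_measure)
    then show ?thesis by (simp add: AE_distr_iff)
  qed
  have ae: "AE z in M \<Otimes>\<^sub>M M. X (snd z) \<noteq> X (fst z)"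
    by (rule P.AE_pair_measure) (auto intro!: AE_I2 no_tie)
  \<comment> \<open>Off the ties exactly one of the two indicators is 1; on a tie the right side
    would count \<open>g\<close> twice.\<close>
  have "(LINT z|(M \<Otimes>\<^sub>M M). g (max (X (fst z)) (X (snd z))))
      = (LINT z|(M \<Otimes>\<^sub>M M). h z + h (snd z, fst z))"
    by (rule integral_cong_AE, measurable)
       (use ae in eventually_elim, auto simp: h_def indicator_def max_def)
  also have "\<dots> = (LINT z|(M \<Otimes>\<^sub>M M). h z) + (LINT z|(M \<Otimes>\<^sub>M M). h (snd z, fst z))"
    using P.integrable_product_swap[OF h_int] h_int
    by (intro Bochner_Integration.integral_add) (auto simp: case_prod_unfold)
  also have "(LINT z|(M \<Otimes>\<^sub>M M). h (snd z, fst z)) = (LINT z|(M \<Otimes>\<^sub>M M). h z)"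
    using P.integral_product_swap[OF h_meas] by (simp add: case_prod_unfold)
  also have "(LINT z|(M \<Otimes>\<^sub>M M). h z) = (LINT x|M. LINT y|M. h (x, y))"
    by (rule P.integral_fst'[OF h_int, symmetric])
  also have "\<dots> = (LINT x|M. g (X x) * distribution_function M X (X x))"
  proof (rule Bochner_Integration.integral_cong[OF refl])
    fix x
    have "(LINT y|M. indicator {..X x} (X y)) = (LINT y|M. indicator {\<omega> \<in> space M. X \<omega> \<le> X x} y :: real)"
      by (rule Bochner_Integration.integral_cong) (auto simp: indicator_def)
    then show "(LINT y|M. h (x, y)) = g (X x) * distribution_function M X (X x)"
      by (simp add: h_def distribution_function_eq_prob)
  qed
  finally show ?thesis by simp
qed

theorem mainTheorem9:
  fixes M :: "'a measure" and X :: "'a \<Rightarrow> real"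
  assumes "prob_space M"
    and "X \<in> borel_measurable M"
    and "AE \<omega> in M. 0 \<le> X \<omega>"
    and "absolutely_continuous_function (distribution_function M X)"
    and "integrable M (\<lambda>\<omega>. (X \<omega>)\<^sup>2)"
  shows "cumulative_extropy M X = - prob_weighted_moment M X 1 1 0
    \<and> weighted_cumulative_extropy M X = - (1 / 2) * prob_weighted_moment M X 2 1 0"
proof -
  interpret prob_space M by fact
  note max_eq = integral_max_independent_copies[OF assms(2)
      absolutely_continuous_function_isCont[OF assms(4)]]
  have "integrable M X"
    using square_integrable_imp_integrable assms by blast
  then show ?thesis
    \<comment> \<open>The factor 2 turns the constants -1/2 and -1/4 into -1 and -1/2. The factor
      with \<open>s = 0\<close> is 1 even where the distribution function equals 1, since
      \<open>real_power 0 0 = 1\<close>.\<close>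
    using max_eq[of "\<lambda>x. x"] max_eq[of "\<lambda>x. x\<^sup>2"] assms(5)
    by (simp add: cumulative_extropy_def weighted_cumulative_extropy_def prob_weighted_moment_def)
qed

end
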